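(* Let $m\ge 1$, let $A\subset\mathbb{R}^m$ be a fixed finite set and $r\in\mathbb{R}^m$ a reference point. For $\mu\in\mathbb{R}^m$ and $\sigma\in(0,\infty)^m$ let $Y=(Y_1,\dots,Y_m)$ have independent Gaussian coordinates $Y_j\sim N(\mu_j,\sigma_j^2)$, and let $\mathrm{EHVI}_A(\mu,\sigma)=\mathbb{E}[I_A(Y)]$ be the expected hypervolume improvement (minimization orientation). Then: (1) (mean monotonicity) if $\mu'_j\le\mu_j$ for all $j$, then $\mathrm{EHVI}_A(\mu',\sigma)\ge \mathrm{EHVI}_A(\mu,\sigma)$; (2) (variance monotonicity) if $\sigma'_j\ge\sigma_j$ for all $j$, then $\mathrm{EHVI}_A(\mu,\sigma')\ge \mathrm{EHVI}_A(\mu,\sigma)$.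
   Context: Minimization convention: smaller objective values are better. For a finite set $A\subset\mathbb{R}^m$ and $r\in\mathbb{R}^m$ the dominated region is $\mathrm{Dom}_r(A)=\bigcup_{a\in A}[a_1,r_1]\times\cdots\times[a_m,r_m]$, where a box is empty if $a_j>r_j$ for some $j$. The hypervolume is $\mathrm{HV}_r(A)=\int_{\mathrm{Dom}_r(A)}1\,dy$ (Lebesgue measure). The hypervolume improvement of $y\in\mathbb{R}^m$ is $I_A(y)=\mathrm{HV}_r(A\cup\{y\})-\mathrm{HV}_r(A)$. *)

theory Defs
  imports "HOL-Probability.Probability"
begin

(* The space R^m is real ^ 'm with a finite index type 'm, so m >= 1 holds automatically.
   Objectives are minimized: a point dominates the region above it, up to the reference point r. *)

definition dominated_region :: "real ^ 'm \<Rightarrow> (real ^ 'm) set \<Rightarrow> (real ^ 'm) set" where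
  "dominated_region r A = (\<Union>a\<in>A. cbox a r)"

definition hypervolume :: "real ^ 'm \<Rightarrow> (real ^ 'm) set \<Rightarrow> real" where
  "hypervolume r A = (LINT y:dominated_region r A|lborel. 1)"

definition hv_improvement :: "real ^ 'm \<Rightarrow> (real ^ 'm) set \<Rightarrow> real ^ 'm \<Rightarrow> real" where
  "hv_improvement r A y = hypervolume r (A \<union> {y}) - hypervolume r A"

(* The entries of \<sigma> are standard deviations (as in normal_density), not variances. *)
definition indep_gaussian ::
    "'w measure \<Rightarrow> ('w \<Rightarrow> real ^ 'm) \<Rightarrow> real ^ 'm \<Rightarrow> real ^ 'm \<Rightarrow> bool" where
  "indep_gaussian M Y \<mu> \<sigma> \<longleftrightarrow>
     prob_space M \<and>
     prob_space.indep_vars M (\<lambda>_. borel) (\<lambda>j \<omega>. Y \<omega> $ j) UNIV \<and>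
     (\<forall>j. distributed M lborel (\<lambda>\<omega>. Y \<omega> $ j) (normal_density (\<mu> $ j) (\<sigma> $ j)))"

(* The expectation of the improvement at Y. It depends on (M, Y) only through the law of Y, hence,
   when indep_gaussian M Y \<mu> \<sigma> holds, only on (\<mu>, \<sigma>). *)
definition EHVI ::
    "real ^ 'm \<Rightarrow> (real ^ 'm) set \<Rightarrow> 'w measure \<Rightarrow> ('w \<Rightarrow> real ^ 'm) \<Rightarrow> real" where
  "EHVI r A M Y = (LINT \<omega>|M. hv_improvement r A (Y \<omega>))"

end

theory Submission
  imports Defs
begin

text \<open>
  Write $I(y)$ for the improvement. It is the volume of the part of the box from \<open>y\<close> to \<open>r\<close> that
  \<open>A\<close> does not dominate. This gives two pointwise properties of $I$ that drive everything.

  \<^item> $I$ does not increase in any coordinate, since lowering \<open>y\<close> enlarges the box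
  (\<open>hv_improvement_antimono\<close>).

  \<^item> $I$ is convex in each single coordinate (\<open>hv_improvement_convex_coordinate\<close>). Moving $y_j$ down
  by $dt$ adds a slab at height $y_j$, and the cross-section of this slab can only grow as $y_j$
  falls: a point that \<open>A\<close> does not dominate stays undominated when it is pushed down. So the
  slope of $I$ in $y_j$ is monotone. Joint convexity fails in general, which is why the variance
  argument treats one coordinate at a time.

  The expected improvement depends only on the law of $Y$, hence only on the parameters
  (\<open>EHVI_cong_parameters\<close>), so two Gaussian vectors may be compared after replacing one of them by
  an affine image of the other. For the means, $Y + \mu' - \mu$ lies below $Y$ and has mean $\mu'$;
  the first property applies pointwise. For the deviations, put $c = \sigma'_j / \sigma_j \ge 1$
  and let $U_\pm$ be $Y$ with its coordinate $j$ replaced by $\mu_j \pm c (Y_j - \mu_j)$. The point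
  $Y_j$ lies between these two values at a ratio that depends on $c$ only, so convexity bounds $I(Y)$
  by a fixed convex combination of $I(U_+)$ and $I(U_-)$. By the symmetry of the Gaussian, $U_+$ and
  $U_-$ have the same law, which is the law of $Y$ with $\sigma_j$ raised to $\sigma'_j$. Thus
  raising one deviation does not lower the expectation, and induction over the coordinates raises
  all of them.

  All integrals involved are finite because $0 \le I(y) \le \prod_j |y_j - r_j|$ and the factors are
  independent and integrable.
\<close>

section \<open>The improvement as a measure\<close>

definition newly_dominated :: "real ^ 'm \<Rightarrow> (real ^ 'm) set \<Rightarrow> real ^ 'm \<Rightarrow> (real ^ 'm) set" where
  "newly_dominated r A y = cbox y r - dominated_region r A"

lemma dominated_region_sets:
  assumes "finite A"
  shows "dominated_region r A \<in> sets borel"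
  unfolding dominated_region_def using assms by (intro borel_closed closed_UN) auto

lemma dominated_region_fmeasurable:
  assumes "finite A"
  shows "dominated_region r A \<in> fmeasurable lborel"
  unfolding dominated_region_def using assms
  by (intro fmeasurable.finite_UN) (auto simp: fmeasurable_def emeasure_lborel_cbox_eq)

lemma newly_dominated_fmeasurable:
  assumes "finite A"
  shows "newly_dominated r A y \<in> fmeasurable lborel"
  unfolding newly_dominated_def using dominated_region_sets[OF assms]
  by (intro fmeasurable_Diff) (auto simp: fmeasurable_def emeasure_lborel_cbox_eq)

lemma newly_dominated_lmeasurable:
  assumes "finite A"
  shows "newly_dominated r A y \<in> lmeasurable"
  using newly_dominated_fmeasurable[OF assms, of r y]
  by (auto simp: fmeasurable_def)

lemma hypervolume_eq_measure:
  "hypervolume r A = measure lborel (dominated_region r A)"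
  unfolding hypervolume_def set_lebesgue_integral_def
  by simp

lemma hv_improvement_eq_measure:
  assumes "finite A"
  shows "hv_improvement r A y = measure lborel (newly_dominated r A y)"
proof -
  have "dominated_region r (A \<union> {y}) = newly_dominated r A y \<union> dominated_region r A"
    by (auto simp: dominated_region_def newly_dominated_def)
  moreover have "newly_dominated r A y \<inter> dominated_region r A = {}"
    by (auto simp: newly_dominated_def)
  ultimately have "measure lborel (dominated_region r (A \<union> {y})) =
      measure lborel (newly_dominated r A y) + measure lborel (dominated_region r A)"
    using newly_dominated_fmeasurable[OF assms, of r y] dominated_region_fmeasurable[OF assms, of r]
    by (simp only:) (rule measure_Union; auto simp: fmeasurable_def less_top)
  then show ?thesis
    using assms by (simp add: hv_improvement_def hypervolume_eq_measure)
qed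

lemma hv_improvement_nonneg:
  assumes "finite A"
  shows "0 \<le> hv_improvement r A y"
  using assms by (simp add: hv_improvement_eq_measure)

section \<open>Monotonicity and convexity of the improvement\<close>

lemma newly_dominated_antimono:
  assumes "\<forall>j. y $ j \<le> y' $ j"
  shows "newly_dominated r A y' \<subseteq> newly_dominated r A y"
  using assms unfolding newly_dominated_def by (auto simp: mem_box_cart) (meson order_trans)

lemma hv_improvement_antimono:
  assumes "finite A" and "\<forall>j. y $ j \<le> y' $ j"
  shows "hv_improvement r A y' \<le> hv_improvement r A y"
  unfolding hv_improvement_eq_measure[OF assms(1)]
  by (intro measure_mono_fmeasurable newly_dominated_antimono newly_dominated_fmeasurable
      fmeasurableD assms)

text \<open>
  Dominance by \<open>A\<close> passes upwards inside the orthant below \<open>r\<close>, so an undominated point may be pushed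
  down freely. This is the source of the convexity below.
\<close>

lemma newly_dominated_lower:
  assumes "z \<in> newly_dominated r A y" and "\<forall>i. w $ i \<le> z $ i" and "\<forall>i. y' $ i \<le> w $ i"
  shows "w \<in> newly_dominated r A y'"
  using assms unfolding newly_dominated_def dominated_region_def
  by (auto simp: mem_box_cart) (meson order_trans)+

definition upd :: "real ^ 'm \<Rightarrow> 'm \<Rightarrow> real \<Rightarrow> real ^ 'm" where
  "upd y j t = (\<chi> i. if i = j then t else y $ i)"

lemma upd_nth [simp]: "upd y j t $ i = (if i = j then t else y $ i)"
  by (simp add: upd_def)

lemma measure_affine_coordinate:
  fixes S :: "(real ^ 'm) set"
  assumes "S \<in> lmeasurable" and "0 \<le> k"
  shows "(\<lambda>z. upd z j (d + k * z $ j)) ` S \<in> lmeasurable"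
    and "measure lebesgue ((\<lambda>z. upd z j (d + k * z $ j)) ` S) = k * measure lebesgue S"
proof -
  let ?m = "\<lambda>i. if i = j then k else 1"
  have eq: "(\<lambda>z. upd z j (d + k * z $ j)) ` S = (+) (axis j d) ` (\<lambda>z. \<chi> i. ?m i * z $ i) ` S"
    unfolding image_image by (rule image_cong) (auto simp: vec_eq_iff axis_def)
  show "(\<lambda>z. upd z j (d + k * z $ j)) ` S \<in> lmeasurable"
    unfolding eq by (intro measurable_translation measurable_stretch assms)
  show "measure lebesgue ((\<lambda>z. upd z j (d + k * z $ j)) ` S) = k * measure lebesgue S"
    unfolding eq measure_translation measure_stretch[OF assms(1)] using assms(2) by simp
qed

text \<open>
  For \<open>a < c < b\<close> the values at \<open>a\<close>, \<open>c\<close>, \<open>b\<close> differ by the volumes of two slabs: \<open>D a - D c\<close>, with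
  coordinate \<open>j\<close> between \<open>a\<close> and \<open>c\<close>, and \<open>D c - D b\<close>, between \<open>c\<close> and \<open>b\<close>. The map \<open>\<phi>\<close> rescales coordinate
  \<open>j\<close> so that the interval from \<open>c\<close> to \<open>b\<close> becomes the one from \<open>a\<close> to \<open>c\<close>. It pushes points down, hence
  sends the upper slab into the lower one, and it multiplies volume by \<open>k = (c - a) / (b - c)\<close>.
  Comparing volumes is exactly the slope inequality of convexity.
\<close>

lemma hv_improvement_convex_coordinate:
  fixes r y :: "real ^ 'm"
  assumes A: "finite A"
  shows "convex_on UNIV (\<lambda>t. hv_improvement r A (upd y j t))"
proof
  fix t a b :: real
  assume t: "0 < t" "t < 1" and "a < b"
  define c where "c = (1 - t) * a + t * b"
  define k where "k = t / (1 - t)"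
  define D where "D s = newly_dominated r A (upd y j s)" for s
  define \<phi> where "\<phi> z = upd z j ((a - k * c) + k * z $ j)" for z :: "real ^ 'm"
  have k: "0 < k" using t by (simp add: k_def)
  have ca: "c - a = t * (b - a)" and bc: "b - c = (1 - t) * (b - a)"
    by (simp_all add: c_def algebra_simps)
  have ac: "a < c" and cb: "c < b"
    using t \<open>a < b\<close> ca bc by (smt (verit) mult_pos_pos)+
  have kbc: "k * (b - c) = c - a"
    unfolding ca bc k_def using t by simp
  have D [intro]: "D s \<in> lmeasurable" for s
    unfolding D_def by (rule newly_dominated_lmeasurable[OF A])
  have H: "hv_improvement r A (upd y j s) = measure lebesgue (D s)" for s
    unfolding D_def hv_improvement_eq_measure[OF A]
    by (rule measure_completion[symmetric]) (rule fmeasurableD[OF newly_dominated_fmeasurable[OF A]])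
  have diff: "measure lebesgue (D s - D s') = measure lebesgue (D s) - measure lebesgue (D s')"
    if "s \<le> s'" for s s'
  proof -
    have "D s' \<subseteq> D s"
      unfolding D_def using that by (intro newly_dominated_antimono) auto
    then show ?thesis
      using D by (intro measurable_measure_Diff) (auto dest: fmeasurableD)
  qed
  have "\<phi> ` (D c - D b) \<subseteq> D a - D c"
  proof safe
    fix z assume z: "z \<in> D c" "z \<notin> D b"
    have zc: "(if i = j then c else y $ i) \<le> z $ i" for i
      using z(1) by (auto simp: D_def newly_dominated_def mem_box_cart)
    have zj: "c \<le> z $ j" using zc[of j] by simp
    have zb: "z $ j < b"
    proof (rule ccontr)
      assume "\<not> z $ j < b"
      have "\<forall>i. upd y j b $ i \<le> z $ i"
      proof (intro allI)
        show "upd y j b $ i \<le> z $ i" for i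
          using zc[of i] \<open>\<not> z $ j < b\<close> by (cases "i = j") auto
      qed
      then have "z \<in> D b"
        unfolding D_def by (intro newly_dominated_lower[OF z(1)[unfolded D_def]]) auto
      with z(2) show False by simp
    qed
    have low: "a \<le> \<phi> z $ j"
      using zj k by (simp add: \<phi>_def algebra_simps)
    have "k * (z $ j - c) < k * (b - c)" using zb k by simp
    then have up: "\<phi> z $ j < c"
      using kbc by (simp add: \<phi>_def algebra_simps)
    have "\<forall>i. \<phi> z $ i \<le> z $ i"
      using up zj by (auto simp: \<phi>_def)
    moreover have "\<forall>i. upd y j a $ i \<le> \<phi> z $ i"
    proof
      show "upd y j a $ i \<le> \<phi> z $ i" for i
        using low zc[of i] by (cases "i = j") (auto simp: \<phi>_def)
    qed
    ultimately show "\<phi> z \<in> D a"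
      using z(1) newly_dominated_lower unfolding D_def by blast
    assume "\<phi> z \<in> D c"
    then have "upd y j c $ j \<le> \<phi> z $ j"
      by (auto simp: D_def newly_dominated_def mem_box_cart simp del: upd_nth)
    then show False using up by simp
  qed
  moreover have Dcb: "D c - D b \<in> lmeasurable" "D a - D c \<in> lmeasurable"
    using D by (auto intro: fmeasurable_Diff dest: fmeasurableD)
  ultimately have "measure lebesgue (\<phi> ` (D c - D b)) \<le> measure lebesgue (D a - D c)"
    using measure_affine_coordinate(1)[OF Dcb(1), of k j "a - k * c"] k
    unfolding \<phi>_def by (intro measure_mono_fmeasurable) (auto dest: fmeasurableD)
  then have "k * measure lebesgue (D c - D b) \<le> measure lebesgue (D a - D c)"
    using measure_affine_coordinate(2)[OF Dcb(1), of k j "a - k * c"] k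
    unfolding \<phi>_def by simp
  then have "k * (measure lebesgue (D c) - measure lebesgue (D b))
      \<le> measure lebesgue (D a) - measure lebesgue (D c)"
    using ac cb by (simp add: diff)
  then have "t * (measure lebesgue (D c) - measure lebesgue (D b))
      \<le> (1 - t) * (measure lebesgue (D a) - measure lebesgue (D c))"
    using t by (simp add: k_def field_simps)
  then show "hv_improvement r A (upd y j ((1 - t) *\<^sub>R a + t *\<^sub>R b))
      \<le> (1 - t) * hv_improvement r A (upd y j a) + t * hv_improvement r A (upd y j b)"
    unfolding H real_scaleR_def c_def[symmetric] by (simp add: algebra_simps)
qed simp

section \<open>Measurability and growth of the improvement\<close>

text \<open>
  Measurability in \<open>y\<close> comes from Fubini: the improvement integrates, over \<open>z\<close>, the indicator of a
  Borel relation between \<open>y\<close> and \<open>z\<close>.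
\<close>

lemma hv_improvement_measurable:
  fixes r :: "real ^ 'm"
  assumes A: "finite A"
  shows "hv_improvement r A \<in> borel_measurable borel"
proof -
  define L where "L = {p :: (real ^ 'm) \<times> (real ^ 'm). \<forall>j. fst p $ j \<le> snd p $ j}"
  have "closed L"
    unfolding L_def by (intro closed_Collect_all closed_Collect_le continuous_intros)
  then have "L \<in> sets (borel \<Otimes>\<^sub>M borel)"
    unfolding borel_prod by (rule borel_closed)
  also have "sets (borel \<Otimes>\<^sub>M borel) = sets (borel \<Otimes>\<^sub>M lborel)"
    by (rule sets_pair_measure_cong) auto
  finally have [measurable]: "L \<in> sets (borel \<Otimes>\<^sub>M lborel)" .
  have [measurable]: "{..r} - dominated_region r A \<in> sets lborel"
    using dominated_region_sets[OF A] by auto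
  have "(\<lambda>y. LINT z|lborel. indicat_real L (y, z) * indicat_real ({..r} - dominated_region r A) z)
      \<in> borel_measurable borel"
    by measurable
  also have "(\<lambda>y. LINT z|lborel. indicat_real L (y, z) * indicat_real ({..r} - dominated_region r A) z)
    = (\<lambda>y. LINT z|lborel. indicator (newly_dominated r A y) z)"
    by (intro ext Bochner_Integration.integral_cong)
      (auto simp: L_def indicator_def newly_dominated_def mem_box_cart less_eq_vec_def)
  also have "\<dots> = hv_improvement r A"
    using A by (simp add: hv_improvement_eq_measure fun_eq_iff)
  finally show ?thesis .
qed

lemma hv_improvement_le_prod:
  assumes A: "finite A"
  shows "hv_improvement r A y \<le> (\<Prod>j\<in>UNIV. \<bar>y $ j - r $ j\<bar>)"
proof -
  have "hv_improvement r A y \<le> measure lborel (cbox y r)"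
    unfolding hv_improvement_eq_measure[OF A] using A
    by (intro measure_mono_fmeasurable)
      (auto simp: newly_dominated_def[of r A y] fmeasurable_def emeasure_lborel_cbox_eq
        dominated_region_sets)
  also have "\<dots> \<le> (\<Prod>j\<in>UNIV. \<bar>y $ j - r $ j\<bar>)"
    unfolding content_cbox_if_cart
    by (auto simp: interval_ne_empty_cart intro!: prod_nonneg prod_mono)
  finally show ?thesis .
qed

section \<open>Vectors of independent Gaussians\<close>

lemma indep_gaussian_coordinate_measurable:
  assumes "indep_gaussian M Y \<mu> \<sigma>"
  shows "(\<lambda>\<omega>. Y \<omega> $ j) \<in> borel_measurable M"
  using assms by (auto simp: indep_gaussian_def distributed_def measurable_lborel1)

lemma borel_measurable_vec:
  fixes f :: "'a \<Rightarrow> real ^ 'm"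
  assumes "\<And>j. (\<lambda>x. f x $ j) \<in> borel_measurable N"
  shows "f \<in> borel_measurable N"
  by (rule borel_measurable_euclidean_space[THEN iffD2])
    (use assms in \<open>auto simp: Basis_vec_def inner_axis\<close>)

text \<open>
  Negative factors are included: reflecting coordinates about their means is what supplies the
  symmetry in the variance argument.
\<close>

lemma indep_gaussian_affine:
  fixes Y :: "'w \<Rightarrow> real ^ 'm"
  assumes Y: "indep_gaussian M Y \<mu> \<sigma>" and \<sigma>: "\<forall>j. 0 < \<sigma> $ j" and c: "\<forall>j. c $ j \<noteq> 0"
  shows "indep_gaussian M (\<lambda>\<omega>. \<chi> j. b $ j + c $ j * Y \<omega> $ j)
    (\<chi> j. b $ j + c $ j * \<mu> $ j) (\<chi> j. \<bar>c $ j\<bar> * \<sigma> $ j)"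
proof -
  interpret prob_space M using Y by (simp add: indep_gaussian_def)
  have "indep_vars (\<lambda>_. borel) (\<lambda>j \<omega>. b $ j + c $ j * Y \<omega> $ j) UNIV"
    using Y unfolding indep_gaussian_def
    by (intro indep_vars_compose2[where X = "\<lambda>j \<omega>. Y \<omega> $ j" and Y = "\<lambda>j x. b $ j + c $ j * x"])
      auto
  then show ?thesis
    using Y \<sigma> c prob_space_axioms unfolding indep_gaussian_def
    by (auto intro!: normal_density_affine)
qed

text \<open>
  By independence the joint law is the product of the marginal laws, in which only the parameters
  occur.
\<close>

lemma indep_gaussian_distr:
  fixes Y :: "'w \<Rightarrow> real ^ 'm"
  assumes Y: "indep_gaussian M Y \<mu> \<sigma>"
  shows "distr M borel Y = distr (\<Pi>\<^sub>M j\<in>UNIV.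
    density lborel (\<lambda>x. ennreal (normal_density (\<mu> $ j) (\<sigma> $ j) x))) borel vec_lambda"
proof -
  interpret prob_space M using Y by (simp add: indep_gaussian_def)
  let ?P = "\<Pi>\<^sub>M (j::'m)\<in>UNIV. (borel :: real measure)"
  have meas: "vec_lambda \<in> borel_measurable ?P"
    by (rule borel_measurable_vec) simp
  have rv: "random_variable borel (\<lambda>\<omega>. Y \<omega> $ j)" for j
    by (rule indep_gaussian_coordinate_measurable[OF Y])
  have "distr M borel Y = distr (distr M ?P (\<lambda>\<omega>. \<lambda>j\<in>UNIV. Y \<omega> $ j)) borel vec_lambda"
    using rv by (subst distr_distr[OF meas])
      (auto simp: comp_def restrict_UNIV intro!: measurable_PiM_single')
  also have "distr M ?P (\<lambda>\<omega>. \<lambda>j\<in>UNIV. Y \<omega> $ j) = (\<Pi>\<^sub>M j\<in>UNIV. distr M borel (\<lambda>\<omega>. Y \<omega> $ j))"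
    using Y rv by (subst indep_vars_iff_distr_eq_PiM[symmetric]) (auto simp: indep_gaussian_def)
  also have "\<dots> = (\<Pi>\<^sub>M j\<in>UNIV. density lborel (\<lambda>x. ennreal (normal_density (\<mu> $ j) (\<sigma> $ j) x)))"
  proof (rule PiM_cong[OF refl])
    fix j :: 'm
    have "distributed M lborel (\<lambda>\<omega>. Y \<omega> $ j) (normal_density (\<mu> $ j) (\<sigma> $ j))"
      using Y by (simp add: indep_gaussian_def)
    then show "distr M borel (\<lambda>\<omega>. Y \<omega> $ j)
        = density lborel (\<lambda>x. ennreal (normal_density (\<mu> $ j) (\<sigma> $ j) x))"
      by (simp add: distributed_def cong: distr_cong)
  qed
  finally show ?thesis .
qed

lemma indep_gaussian_measurable:
  assumes "indep_gaussian M Y \<mu> \<sigma>"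
  shows "Y \<in> borel_measurable M"
  using indep_gaussian_coordinate_measurable[OF assms] by (rule borel_measurable_vec)

lemma EHVI_eq_integral_law:
  assumes "finite A" and "Y \<in> borel_measurable M"
  shows "EHVI r A M Y = (LINT y|distr M borel Y. hv_improvement r A y)"
  unfolding EHVI_def using assms hv_improvement_measurable[OF assms(1)]
  by (subst integral_distr) auto

lemma EHVI_cong_parameters:
  assumes A: "finite A" and Y: "indep_gaussian M Y \<mu> \<sigma>" and Y': "indep_gaussian M' Y' \<mu> \<sigma>"
  shows "EHVI r A M Y = EHVI r A M' Y'"
  unfolding EHVI_eq_integral_law[OF A indep_gaussian_measurable[OF Y]]
    EHVI_eq_integral_law[OF A indep_gaussian_measurable[OF Y']]
    indep_gaussian_distr[OF Y] indep_gaussian_distr[OF Y'] ..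

lemma hv_improvement_integrable:
  fixes Y :: "'w \<Rightarrow> real ^ 'm"
  assumes A: "finite A" and Y: "indep_gaussian M Y \<mu> \<sigma>" and \<sigma>: "\<forall>j. 0 < \<sigma> $ j"
  shows "integrable M (\<lambda>\<omega>. hv_improvement r A (Y \<omega>))"
proof -
  interpret prob_space M using Y by (simp add: indep_gaussian_def)
  have coord: "integrable M (\<lambda>\<omega>. Y \<omega> $ j)" for j
  proof -
    have "distributed M lborel (\<lambda>\<omega>. Y \<omega> $ j) (normal_density (\<mu> $ j) (\<sigma> $ j))"
      using Y by (simp add: indep_gaussian_def)
    then show ?thesis
      using integrable_normal_moment_nz_1[of "\<sigma> $ j" "\<mu> $ j"] \<sigma>
        distributed_integrable[of M lborel _ "normal_density (\<mu> $ j) (\<sigma> $ j)" "\<lambda>x. x"] 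
      by auto
  qed
  have "indep_vars (\<lambda>_. borel) (\<lambda>j \<omega>. \<bar>Y \<omega> $ j - r $ j\<bar>) UNIV"
    using Y unfolding indep_gaussian_def
    by (intro indep_vars_compose2[where X = "\<lambda>j \<omega>. Y \<omega> $ j" and Y = "\<lambda>j x. \<bar>x - r $ j\<bar>"]) auto
  then have "integrable M (\<lambda>\<omega>. \<Prod>j\<in>UNIV. \<bar>Y \<omega> $ j - r $ j\<bar>)"
    using coord by (intro indep_vars_integrable) auto
  then show ?thesis
    by (rule Bochner_Integration.integrable_bound)
      (use A indep_gaussian_measurable[OF Y] hv_improvement_measurable[OF A] in
        \<open>auto simp: hv_improvement_nonneg intro!: AE_I2 order_trans[OF hv_improvement_le_prod]
          measurable_compose[of Y M borel]\<close>)
qed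

section \<open>Monotonicity of the expected improvement\<close>

text \<open>
  Coupling: the second vector may be taken to be the first one shifted down by \<open>\<mu> - \<mu>'\<close>.
\<close>

lemma EHVI_antimono_mean:
  fixes Y :: "'w \<Rightarrow> real ^ 'm"
  assumes A: "finite A" and \<sigma>: "\<forall>j. 0 < \<sigma> $ j"
    and Y: "indep_gaussian M Y \<mu> \<sigma>" and Y': "indep_gaussian M' Y' \<mu>' \<sigma>"
    and le: "\<forall>j. \<mu>' $ j \<le> \<mu> $ j"
  shows "EHVI r A M Y \<le> EHVI r A M' Y'"
proof -
  define Z where "Z \<omega> = (\<chi> j. (\<mu>' - \<mu>) $ j + (\<chi> j. 1) $ j * Y \<omega> $ j)" for \<omega>
  have "indep_gaussian M Z (\<chi> j. (\<mu>' - \<mu>) $ j + (\<chi> j. 1) $ j * \<mu> $ j)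
      (\<chi> j. \<bar>(\<chi> j. 1) $ j\<bar> * \<sigma> $ j)"
    unfolding Z_def using Y \<sigma> by (rule indep_gaussian_affine) simp
  then have Z: "indep_gaussian M Z \<mu>' \<sigma>" by simp
  have "EHVI r A M Y \<le> EHVI r A M Z"
    unfolding EHVI_def
    using hv_improvement_integrable[OF A Y \<sigma>] hv_improvement_integrable[OF A Z \<sigma>]
  proof (rule integral_mono)
    show "hv_improvement r A (Y \<omega>) \<le> hv_improvement r A (Z \<omega>)" for \<omega>
      using A le by (intro hv_improvement_antimono) (auto simp: Z_def)
  qed
  also have "EHVI r A M Z = EHVI r A M' Y'"
    using A Z Y' by (rule EHVI_cong_parameters)
  finally show ?thesis .
qed

text \<open>
  Jensen's inequality for a two-point mixture: \<open>Y\<close> lies between its dilation by \<open>c\<close> in coordinate \<open>j\<close>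
  and the mirror image of that dilation, and the two are equal in law.
\<close>

lemma EHVI_mono_deviation_coordinate:
  fixes Y :: "'w \<Rightarrow> real ^ 'm"
  assumes A: "finite A" and \<sigma>: "\<forall>j. 0 < \<sigma> $ j" and Y: "indep_gaussian M Y \<mu> \<sigma>"
    and s: "\<sigma> $ j \<le> s"
  shows "\<exists>Z. indep_gaussian M Z \<mu> (upd \<sigma> j s) \<and> EHVI r A M Y \<le> EHVI r A M Z"
proof -
  define c where "c = s / \<sigma> $ j"
  have c: "1 \<le> c" "c * \<sigma> $ j = s"
    using s \<sigma>[rule_format, of j] by (auto simp: c_def field_simps)
  \<comment> \<open>\<open>U 1\<close> is the dilation and \<open>U (-1)\<close> its mirror image\<close>
  define U where "U \<epsilon> \<omega> = upd (Y \<omega>) j (\<mu> $ j + \<epsilon> * c * (Y \<omega> $ j - \<mu> $ j))" for \<epsilon> \<omega>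
  have U: "indep_gaussian M (U \<epsilon>) \<mu> (upd \<sigma> j s)" if "\<bar>\<epsilon>\<bar> = 1" for \<epsilon>
  proof -
    define b d where "b = upd 0 j (\<mu> $ j - \<epsilon> * c * \<mu> $ j)" and "d = upd 1 j (\<epsilon> * c)"
    have "indep_gaussian M (\<lambda>\<omega>. \<chi> i. b $ i + d $ i * Y \<omega> $ i)
        (\<chi> i. b $ i + d $ i * \<mu> $ i) (\<chi> i. \<bar>d $ i\<bar> * \<sigma> $ i)"
      using Y \<sigma> by (rule indep_gaussian_affine) (use c that in \<open>auto simp: d_def\<close>)
    also have "(\<lambda>\<omega>. \<chi> i. b $ i + d $ i * Y \<omega> $ i) = U \<epsilon>"
      by (auto simp: fun_eq_iff vec_eq_iff U_def b_def d_def algebra_simps)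
    also have "(\<chi> i. b $ i + d $ i * \<mu> $ i) = \<mu>"
      by (auto simp: vec_eq_iff b_def d_def)
    also have "(\<chi> i. \<bar>d $ i\<bar> * \<sigma> $ i) = upd \<sigma> j s"
      using c that by (auto simp: vec_eq_iff d_def abs_mult)
    finally show ?thesis .
  qed
  have pos: "\<forall>i. 0 < upd \<sigma> j s $ i"
    using \<sigma> s by (auto intro: less_le_trans)
  have int: "integrable M (\<lambda>\<omega>. hv_improvement r A (U \<epsilon> \<omega>))" if "\<bar>\<epsilon>\<bar> = 1" for \<epsilon>
    using A U[OF that] pos by (rule hv_improvement_integrable)
  \<comment> \<open>the weight for which \<open>(1 - t) * (- c * x) + t * (c * x) = x\<close>\<close>
  define t where "t = (1 + 1 / c) / 2"
  have t: "0 \<le> t" "t \<le> 1" and tc: "(2 * t - 1) * c = 1"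
    using c by (auto simp: t_def field_simps)
  have pointwise: "hv_improvement r A (Y \<omega>)
      \<le> (1 - t) * hv_improvement r A (U (-1) \<omega>) + t * hv_improvement r A (U 1 \<omega>)" for \<omega>
  proof -
    define x where "x = Y \<omega> $ j - \<mu> $ j"
    have "(1 - t) * (\<mu> $ j - c * x) + t * (\<mu> $ j + c * x) = \<mu> $ j + ((2 * t - 1) * c) * x"
      by (simp add: algebra_simps)
    also have "\<dots> = Y \<omega> $ j" by (simp add: tc x_def)
    finally have "upd (Y \<omega>) j ((1 - t) *\<^sub>R (\<mu> $ j - c * x) + t *\<^sub>R (\<mu> $ j + c * x)) = Y \<omega>"
      by (simp add: vec_eq_iff)
    then show ?thesis
      using convex_onD[OF hv_improvement_convex_coordinate[OF A, of r "Y \<omega>" j] t,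
          of "\<mu> $ j - c * x" "\<mu> $ j + c * x"]
      by (simp add: U_def x_def)
  qed
  have "EHVI r A M Y
      \<le> (LINT \<omega>|M. (1 - t) * hv_improvement r A (U (-1) \<omega>) + t * hv_improvement r A (U 1 \<omega>))"
    unfolding EHVI_def
    using hv_improvement_integrable[OF A Y \<sigma>] int pointwise by (intro integral_mono) auto
  also have "\<dots> = (1 - t) * EHVI r A M (U (-1)) + t * EHVI r A M (U 1)"
    unfolding EHVI_def using int by simp
  also have "EHVI r A M (U (-1)) = EHVI r A M (U 1)"
    using A U[of "-1"] U[of 1] by (intro EHVI_cong_parameters) auto
  finally have "EHVI r A M Y \<le> EHVI r A M (U 1)"
    by (simp add: algebra_simps)
  then show ?thesis using U[of 1] by auto
qed

lemma EHVI_mono_deviation: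
  fixes Y :: "'w \<Rightarrow> real ^ 'm"
  assumes A: "finite A" and \<sigma>: "\<forall>j. 0 < \<sigma> $ j"
    and Y: "indep_gaussian M Y \<mu> \<sigma>" and Y': "indep_gaussian M' Y' \<mu> \<sigma>'"
    and le: "\<forall>j. \<sigma> $ j \<le> \<sigma>' $ j"
  shows "EHVI r A M Y \<le> EHVI r A M' Y'"
proof -
  \<comment> \<open>the deviations after the coordinates in \<open>S\<close> have been raised\<close>
  define \<tau> where "\<tau> S = (\<chi> j. if j \<in> S then \<sigma>' $ j else \<sigma> $ j)" for S
  have \<tau>: "\<forall>j. 0 < \<tau> S $ j" for S
    using \<sigma> le by (auto simp: \<tau>_def intro: less_le_trans)
  have "\<exists>Z. indep_gaussian M Z \<mu> (\<tau> S) \<and> EHVI r A M Y \<le> EHVI r A M Z" if "finite S" for S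
    using that
  proof induction
    case empty
    have "\<tau> {} = \<sigma>" by (simp add: \<tau>_def vec_eq_iff)
    then show ?case using Y by auto
  next
    case (insert j S)
    then obtain Z where Z: "indep_gaussian M Z \<mu> (\<tau> S)" "EHVI r A M Y \<le> EHVI r A M Z"
      by blast
    have "upd (\<tau> S) j (\<sigma>' $ j) = \<tau> (insert j S)"
      by (auto simp: \<tau>_def vec_eq_iff)
    moreover have "\<tau> S $ j \<le> \<sigma>' $ j"
      using le by (simp add: \<tau>_def)
    ultimately show ?case
      using EHVI_mono_deviation_coordinate[OF A \<tau> Z(1), of j "\<sigma>' $ j" r] Z(2)
      by (metis order_trans)
  qed
  from this[OF finite] obtain Z
    where Z: "indep_gaussian M Z \<mu> (\<tau> UNIV)" "EHVI r A M Y \<le> EHVI r A M Z" by blast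
  have "\<tau> UNIV = \<sigma>'" by (simp add: \<tau>_def vec_eq_iff)
  then have "EHVI r A M Z = EHVI r A M' Y'"
    using A Z(1) Y' by (intro EHVI_cong_parameters) auto
  with Z(2) show ?thesis by simp
qed

theorem theorem3p2:
  fixes A :: "(real ^ 'm) set" and r \<mu> \<sigma> :: "real ^ 'm"
    and M :: "'w measure" and Y :: "'w \<Rightarrow> real ^ 'm"
  assumes "finite A"
    and "\<forall>j. \<sigma> $ j > 0"
    and "indep_gaussian M Y \<mu> \<sigma>"
  shows "(\<forall>\<mu>' (M' :: 'v measure) Y'.
            (\<forall>j. \<mu>' $ j \<le> \<mu> $ j) \<and> indep_gaussian M' Y' \<mu>' \<sigma> \<longrightarrow>
              EHVI r A M' Y' \<ge> EHVI r A M Y) \<and>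
         (\<forall>\<sigma>' (M' :: 'v measure) Y'.
            (\<forall>j. \<sigma>' $ j \<ge> \<sigma> $ j) \<and> indep_gaussian M' Y' \<mu> \<sigma>' \<longrightarrow>
              EHVI r A M' Y' \<ge> EHVI r A M Y)"
  using EHVI_antimono_mean[OF assms(1,2,3)] EHVI_mono_deviation[OF assms(1,2,3)] by blast

end
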